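(* Let $P,Q\in\mathbb{Z}$ with $PQ\neq 0$, let $p$ be a prime with $p\mid P$ and $p\mid Q$, and let $r$ be an integer. Then $\mathcal{L}(P,Q,p^{-r})$ is a numerical semigroup, i.e., $\mathbb{N}\setminus\mathcal{L}(P,Q,p^{-r})$ is finite.
   Context: $\mathbb{N}=\{0,1,2,\ldots\}$. For $P,Q\in\mathbb{Z}$, the Lucas sequence $U_n=U_n(P,Q)$ is defined by $U_0=0$, $U_1=1$, $U_{n+2}=PU_{n+1}-QU_n$. For $R\in\mathbb{Q}$, $\mathcal{L}(P,Q,R)=\{n\in\mathbb{N} : U_nR\in\mathbb{Z}\}$. A prime $p$ is special if $p\mid\gcd(P,Q)$. A numerical semigroup is an additive submonoid of $\mathbb{N}$ with finite complement. *)

theory Defs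
  imports Complex_Main "HOL-Computational_Algebra.Primes"
begin

fun lucas_U :: "int \<Rightarrow> int \<Rightarrow> nat \<Rightarrow> int" where
  "lucas_U P Q 0 = 0"
| "lucas_U P Q (Suc 0) = 1"
| "lucas_U P Q (Suc (Suc n)) = P * lucas_U P Q (Suc n) - Q * lucas_U P Q n"

definition lucas_set :: "int \<Rightarrow> int \<Rightarrow> rat \<Rightarrow> nat set" where
  "lucas_set P Q R = {n. of_int (lucas_U P Q n) * R \<in> \<int>}"

definition numerical_semigroup :: "nat set \<Rightarrow> bool" where
  "numerical_semigroup S \<longleftrightarrow>
     0 \<in> S \<and> (\<forall>m\<in>S. \<forall>n\<in>S. m + n \<in> S) \<and> finite (UNIV - S)"

end

(* If p divides both P and Q, the recurrence gains a factor p every two steps, so p^k divides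
   U_n as soon as n \<ge> 2k. The addition formula U_(m+n+1) = U_(m+1) U_(n+1) - Q U_m U_n gives
   closure under addition for every R. *)
theory Submission
  imports Defs
begin

text \<open>For fixed \<open>m\<close>, both sides satisfy the Lucas recurrence in \<open>n\<close>,
  so agreement at \<open>n = 0\<close> and \<open>n = 1\<close> suffices.\<close>

lemma lucas_U_add_Suc:
  "lucas_U P Q (m + Suc n) = lucas_U P Q (Suc m) * lucas_U P Q (Suc n) - Q * lucas_U P Q m * lucas_U P Q n"
proof (induction P Q n rule: lucas_U.induct)
  case (3 P Q n)
  have "lucas_U P Q (m + Suc (Suc (Suc n)))
      = P * lucas_U P Q (m + Suc (Suc n)) - Q * lucas_U P Q (m + Suc n)"
    by simp
  then show ?case
    unfolding 3 by (simp add: algebra_simps)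
qed simp_all

lemma lucas_set_add:
  assumes "m \<in> lucas_set P Q R" and "n \<in> lucas_set P Q R"
  shows "m + n \<in> lucas_set P Q R"
proof (cases n)
  case 0
  then show ?thesis using assms by simp
next
  case (Suc k)
  \<comment> \<open>An integer combination of the two integers \<open>U_n R\<close> and
    \<open>U_m R\<close>; the formula needs \<open>n\<close> to be a successor, hence the case
    split.\<close>
  have "of_int (lucas_U P Q (m + n)) * R
      = of_int (lucas_U P Q (Suc m)) * (of_int (lucas_U P Q n) * R)
        - of_int (Q * lucas_U P Q k) * (of_int (lucas_U P Q m) * R)"
    unfolding Suc lucas_U_add_Suc by (simp add: algebra_simps)
  also have "\<dots> \<in> \<int>"
    using assms unfolding lucas_set_def by (blast intro: Ints_diff Ints_mult Ints_of_int)
  finally show ?thesis by (simp add: lucas_set_def)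
qed

lemma power_dvd_lucas_U:
  assumes "d dvd P" and "d dvd Q"
  shows "d ^ (n div 2) dvd lucas_U P Q n"
  using assms
proof (induction P Q n rule: lucas_U.induct)
  case (3 P Q n)
  have "d ^ (Suc n div 2) dvd lucas_U P Q (Suc n)"
    using 3 by blast
  \<comment> \<open>Weakened to the exponent available for \<open>U_n\<close>, so that the factor
    \<open>d\<close> of \<open>P\<close> and of \<open>Q\<close> raises both terms to exponent
    \<open>n div 2 + 1\<close>.\<close>
  then have "d ^ (n div 2) dvd lucas_U P Q (Suc n)"
    by (rule power_le_dvd) (simp add: div_le_mono)
  then have "d * d ^ (n div 2) dvd P * lucas_U P Q (Suc n) - Q * lucas_U P Q n"
    using 3 by (intro dvd_diff mult_dvd_mono) auto
  then show ?case by simp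
qed simp_all

text \<open>Since \<open>nat r\<close> is 0 for negative \<open>r\<close>, one bound serves both
  signs: for \<open>r \<le> 0\<close> it admits every \<open>n\<close>.\<close>

lemma lucas_set_powi_ge:
  assumes "0 < p" and "int p dvd P" and "int p dvd Q" and "2 * nat r \<le> n"
  shows "n \<in> lucas_set P Q (of_nat p powi (- r))"
proof -
  have "nat r \<le> n div 2" using assms(4) by linarith
  then have "int p ^ nat r dvd lucas_U P Q n"
    using power_dvd_lucas_U[OF assms(2,3)] by (rule power_le_dvd[rotated])
  then obtain c where "lucas_U P Q n = int p ^ nat r * c" ..
  then have "of_int (lucas_U P Q n) * of_nat p powi (- r)
      = (of_int c * (of_nat p powi int (nat r) * of_nat p powi (- r)) :: rat)"
    by (simp only: power_int_of_nat of_int_mult of_int_power of_int_of_nat_eq mult_ac)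
  also have "\<dots> = of_int c * of_nat p powi (int (nat r) - r)"
    using \<open>0 < p\<close> by (simp add: power_int_add[symmetric])
  \<comment> \<open>The exponent is \<open>max 0 (-r)\<close>, hence nonnegative, and the power of
    \<open>p\<close> is an integer.\<close>
  also have "\<dots> = of_int c * of_nat p ^ nat (int (nat r) - r)"
    by (simp add: power_int_def)
  also have "\<dots> \<in> \<int>" by (intro Ints_mult Ints_power) auto
  finally show ?thesis by (simp add: lucas_set_def)
qed

theorem theorem5p1:
  fixes P Q r :: int and p :: nat
  assumes "P * Q \<noteq> 0"
    and "prime p"
    and "int p dvd P" and "int p dvd Q"
  shows "numerical_semigroup (lucas_set P Q (of_nat p powi (- r)))"
proof -
  let ?S = "lucas_set P Q (of_nat p powi (- r))"
  have "UNIV - ?S \<subseteq> {..<2 * nat r}"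
    using lucas_set_powi_ge[OF prime_gt_0_nat[OF assms(2)] assms(3,4)]
    by (auto simp: not_le[symmetric])
  then have "finite (UNIV - ?S)" by (rule finite_subset) simp
  moreover have "0 \<in> ?S" by (simp add: lucas_set_def)
  ultimately show ?thesis
    unfolding numerical_semigroup_def using lucas_set_add by blast
qed

end
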